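(* Let $\theta>0$, and let $(u(t),v(t))$, $t\in[-\theta,\theta]$, be the parametric curve in $\mathbb{R}_+^2$ given by $$u(t)=\begin{cases}\theta & t\le0\\ \theta-|t| & t\ge0\end{cases},\qquad v(t)=\begin{cases}\theta-|t| & t\le0\\ \theta & t\ge0\end{cases},$$ and let $\square(u(t),v(t))=[0,u(t)]\times[0,v(t)]$. For any point configuration $\Pi\in\mathcal{C}^\theta$, let $\pi(t)$ be the permutation associated with the configuration $\Pi\cap\square(u(t),v(t))$, and let $\lambda_\Pi(t)$ be the common shape of the pair of standard Young tableaux obtained by applying the Robinson–Schensted correspondence to $\pi(t)$. If $(\tilde L,\tilde R)$ is the pair of decorated Young tableaux corresponding to $\Pi$ under the decorated RS bijection, then its Young diagram process is exactly $\lambda_\Pi$: $$\lambda_{\tilde L,\tilde R}(t)=\lambda_\Pi(t)\qquad\forall t\in[-\theta,\theta].$$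
   Context: Young diagrams are identified with sets of boxes: $(i,j)\in\lambda$ iff $j\le\lambda_i$. $T(i,j)$ is the entry of a tableau $T$ in box $(i,j)$. Robinson–Schensted (RS) correspondence: the bijection from $S_n$ to pairs $(L,R)$ of standard Young tableaux of the same shape and size $n$, where $L$ is the insertion tableau obtained by row-inserting $\sigma(1),\dots,\sigma(n)$ and $R$ is the recording tableau (the empty permutation corresponds to the empty tableaux). $\mathcal{C}^\theta$ is the set of finite point configurations $\Pi\subset[0,\theta]^2$ with no two points on a common horizontal or vertical line. The permutation associated with a configuration $\Pi$ of $n$ points, with sorted $x$-coordinates $r_1<\dots<r_n$ and sorted $y$-coordinates $\ell_1<\dots<\ell_n$, is the unique $\sigma\in S_n$ with $\Pi=\{(r_i,\ell_{\sigma(i)})\}_{i=1}^n$. Decorated RS bijection: $\Pi$ corresponds to the pair $(\tilde L,\tilde R)$ with $\tilde L=(L,(\ell_1,\dots,\ell_n))$, $\tilde R=(R,(r_1,\dots,r_n))$, where $(L,R)$ is the RS pair of the associated permutation $\sigma$. Young diagram process of $(\tilde L,\tilde R)$: put $\lambda_{\tilde L}(u)=\{(i,j):\ell_{L(i,j)}\le u\}$ and $\lambda_{\tilde R}(u)=\{(i,j):r_{R(i,j)}\le u\}$ for $u\geq 0$; for $t\in[-\theta,\theta]$, $\lambda_{\tilde L,\tilde R}(t)=\lambda_{\tilde L}(\theta+t)$ if $t\le0$ and $\lambda_{\tilde L,\tilde R}(t)=\lambda_{\tilde R}(\theta-t)$ if $t\ge0$ (these agree at $t=0$). *)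

theory Defs
  imports Complex_Main "HOL-Combinatorics.Permutations"
begin

text \<open>A tableau is the list of its rows, top row first. Rows, columns and boxes are numbered
  from 1, list positions from 0. A Young diagram is a set of boxes.\<close>

type_synonym tableau = "nat list list"

definition shape :: "tableau \<Rightarrow> (nat \<times> nat) set" where
  "shape T = {(i, j). 1 \<le> i \<and> i \<le> length T \<and> 1 \<le> j \<and> j \<le> length (T ! (i - 1))}"

definition entry :: "tableau \<Rightarrow> nat \<Rightarrow> nat \<Rightarrow> nat" where
  "entry T i j = T ! (i - 1) ! (j - 1)"

text \<open>Insertion into one row: the leftmost entry greater than \<open>x\<close> is replaced by \<open>x\<close> and
  returned as the bumped entry; if there is none, \<open>x\<close> is appended.\<close>

fun insert_row :: "nat \<Rightarrow> nat list \<Rightarrow> nat list \<times> nat option" where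
  "insert_row x [] = ([x], None)"
| "insert_row x (y # ys) =
     (if x < y then (x # ys, Some y)
      else (let (zs, b) = insert_row x ys in (y # zs, b)))"

text \<open>The second component of the result is the list position of the row that gained a box.\<close>

fun row_insert :: "nat \<Rightarrow> tableau \<Rightarrow> tableau \<times> nat" where
  "row_insert x [] = ([[x]], 0)"
| "row_insert x (row # T) =
     (case insert_row x row of
        (row', None) \<Rightarrow> (row' # T, 0)
      | (row', Some y) \<Rightarrow> (let (T', k) = row_insert y T in (row' # T', Suc k)))"

definition append_at :: "nat \<Rightarrow> nat \<Rightarrow> tableau \<Rightarrow> tableau" where
  "append_at m k T = (if k < length T then T[k := T ! k @ [m]] else T @ [[m]])"

text \<open>\<open>RS n \<sigma>\<close> is the pair of the insertion tableau and the recording tableau of the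
  permutation \<open>\<sigma>\<close> of \<open>{1..n}\<close>.\<close>

primrec RS :: "nat \<Rightarrow> (nat \<Rightarrow> nat) \<Rightarrow> tableau \<times> tableau" where
  "RS 0 \<sigma> = ([], [])"
| "RS (Suc n) \<sigma> =
     (let (L, R) = RS n \<sigma>; (L', k) = row_insert (\<sigma> (Suc n)) L
      in (L', append_at (Suc n) k R))"

lemma insert_row_length:
  "length (fst (insert_row x ys)) =
     (if snd (insert_row x ys) = None then Suc (length ys) else length ys)"
  by (induction ys) (auto split: prod.splits)

lemma row_insert_lengths:
  assumes "map length T = map length R"
  shows "map length (fst (row_insert x T)) =
         map length (append_at m (snd (row_insert x T)) R)"
  using assms
proof (induction T arbitrary: x R)
  case Nil
  then show ?case by (simp add: append_at_def)
next
  case (Cons row T)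
  from Cons.prems obtain r R' where R: "R = r # R'"
    and len: "length row = length r" "map length T = map length R'"
    by auto
  obtain row' b where ins: "insert_row x row = (row', b)" by fastforce
  show ?case
  proof (cases b)
    case None
    with ins R len insert_row_length[of x row] show ?thesis
      by (simp add: append_at_def)
  next
    case (Some y)
    obtain T' k where rec: "row_insert y T = (T', k)" by fastforce
    from Cons.IH[OF len(2), of y] rec
    have "map length T' = map length (append_at m k R')" by simp
    with ins Some rec R len insert_row_length[of x row] show ?thesis
      by (simp add: append_at_def split: if_splits)
  qed
qed

lemma RS_lengths: "map length (fst (RS n \<sigma>)) = map length (snd (RS n \<sigma>))"
proof (induction n)
  case (Suc n)
  then show ?case
    using row_insert_lengths[of "fst (RS n \<sigma>)" "snd (RS n \<sigma>)" "\<sigma> (Suc n)" "Suc n"]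
    by (simp add: case_prod_beta)
qed simp

lemma RS_common_shape: "shape (fst (RS n \<sigma>)) = shape (snd (RS n \<sigma>))"
proof -
  have eq: "length (fst (RS n \<sigma>)) = length (snd (RS n \<sigma>))"
    using RS_lengths[of n \<sigma>] by (metis length_map)
  have "length (fst (RS n \<sigma>) ! k) = length (snd (RS n \<sigma>) ! k)"
    if "k < length (snd (RS n \<sigma>))" for k
    using RS_lengths[of n \<sigma>] that eq by (metis nth_map)
  with eq show ?thesis unfolding shape_def by auto
qed

lemma insert_row_set:
  "set (fst (insert_row x ys)) \<union> set_option (snd (insert_row x ys)) = insert x (set ys)"
proof (induction ys)
  case (Cons y ys)
  show ?case
  proof (cases "x < y")
    case False
    then have "set (fst (insert_row x (y # ys))) \<union> set_option (snd (insert_row x (y # ys))) =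
        insert y (set (fst (insert_row x ys)) \<union> set_option (snd (insert_row x ys)))"
      by (simp add: case_prod_beta)
    also have "\<dots> = insert y (insert x (set ys))" by (simp only: Cons.IH)
    finally show ?thesis by (simp add: insert_commute)
  qed auto
qed simp

lemma row_insert_set:
  "\<Union>(set ` set (fst (row_insert x T))) = insert x (\<Union>(set ` set T))"
proof (induction T arbitrary: x)
  case (Cons row T)
  obtain row' b where ins: "insert_row x row = (row', b)" by fastforce
  show ?case
  proof (cases b)
    case None
    with ins insert_row_set[of x row] show ?thesis by auto
  next
    case (Some y)
    obtain T' k where rec: "row_insert y T = (T', k)" by fastforce
    have "\<Union>(set ` set T') = insert y (\<Union>(set ` set T))" using Cons.IH[of y] rec by simp
    moreover have "insert y (set row') = insert x (set row)"
      using insert_row_set[of x row] ins Some by auto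
    moreover have "\<Union>(set ` set (fst (row_insert x (row # T)))) = set row' \<union> \<Union>(set ` set T')"
      using ins Some rec by simp
    ultimately show ?thesis by (simp; blast)
  qed
qed simp

lemma append_at_set: "\<Union>(set ` set (append_at m k T)) = insert m (\<Union>(set ` set T))"
proof (cases "k < length T")
  case True
  then have "set T = set (take k T @ T ! k # drop (Suc k) T)"
    by (rule arg_cong[OF id_take_nth_drop])
  with True show ?thesis by (auto simp: append_at_def upd_conv_take_nth_drop)
qed (auto simp: append_at_def)

lemma RS_entries:
  "\<Union>(set ` set (fst (RS n \<sigma>))) = \<sigma> ` {1..n}"
  "\<Union>(set ` set (snd (RS n \<sigma>))) = {1..n}"
proof (induction n)
  case (Suc n)
  have "{1..Suc n} = insert (Suc n) {1..n}" by auto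
  with Suc show "\<Union>(set ` set (fst (RS (Suc n) \<sigma>))) = \<sigma> ` {1..Suc n}"
    and "\<Union>(set ` set (snd (RS (Suc n) \<sigma>))) = {1..Suc n}"
    by (simp_all add: case_prod_beta row_insert_set append_at_set del: UN_simps)
qed simp_all

lemma entry_in_set:
  assumes "(i, j) \<in> shape T"
  shows "entry T i j \<in> \<Union>(set ` set T)"
proof -
  have "i - 1 < length T" "j - 1 < length (T ! (i - 1))"
    using assms by (auto simp: shape_def)
  then have "T ! (i - 1) \<in> set T" "entry T i j \<in> set (T ! (i - 1))"
    unfolding entry_def by simp_all
  then show ?thesis by blast
qed

definition RS_shape :: "nat \<Rightarrow> (nat \<Rightarrow> nat) \<Rightarrow> (nat \<times> nat) set" where
  "RS_shape n \<sigma> = shape (fst (RS n \<sigma>))"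

definition configurations :: "real \<Rightarrow> (real \<times> real) set set" where
  "configurations \<theta> =
     {P. finite P \<and> P \<subseteq> {0..\<theta>} \<times> {0..\<theta>} \<and> inj_on fst P \<and> inj_on snd P}"

definition xcoords :: "(real \<times> real) set \<Rightarrow> real list" where
  "xcoords P = sorted_list_of_set (fst ` P)"

definition ycoords :: "(real \<times> real) set \<Rightarrow> real list" where
  "ycoords P = sorted_list_of_set (snd ` P)"

text \<open>\<open>nth1 zs k\<close> is the \<open>k\<close>-th element of \<open>zs\<close>, counted from 1.\<close>

definition nth1 :: "'a list \<Rightarrow> nat \<Rightarrow> 'a" where
  "nth1 zs k = zs ! (k - 1)"

definition config_perm :: "(real \<times> real) set \<Rightarrow> nat \<Rightarrow> nat" where
  "config_perm P =
     (THE \<sigma>. \<sigma> permutes {1..card P} \<and>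
        P = {(nth1 (xcoords P) i, nth1 (ycoords P) (\<sigma> i)) | i. i \<in> {1..card P}})"

lemma nth1_bij_betw:
  assumes "finite A"
  shows "bij_betw (nth1 (sorted_list_of_set A)) {1..card A} A"
proof -
  have "bij_betw (\<lambda>k. k - 1) {1..card A} {..<card A}"
    by (rule bij_betw_byWitness[where f' = Suc]) auto
  moreover have "bij_betw ((!) (sorted_list_of_set A)) {..<card A} A"
    using assms by (intro bij_betw_nth) auto
  ultimately show ?thesis
    using bij_betw_trans unfolding nth1_def comp_def by fastforce
qed

lemma config_perm_ex1:
  assumes "P \<in> configurations \<theta>"
  shows "\<exists>!\<sigma>. \<sigma> permutes {1..card P} \<and>
     P = {(nth1 (xcoords P) i, nth1 (ycoords P) (\<sigma> i)) | i. i \<in> {1..card P}}"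
proof -
  let ?I = "{1..card P}" and ?r = "nth1 (xcoords P)" and ?l = "nth1 (ycoords P)"
  have fin: "finite P" and inj: "inj_on fst P" "inj_on snd P"
    using assms by (auto simp: configurations_def)
  have r: "bij_betw ?r ?I (fst ` P)"
    using nth1_bij_betw[of "fst ` P"] fin inj by (simp add: xcoords_def card_image)
  have l: "bij_betw ?l ?I (snd ` P)"
    using nth1_bij_betw[of "snd ` P"] fin inj by (simp add: ycoords_def card_image)
  define p where "p = inv_into P fst"
  define q where "q = inv_into ?I ?l"
  have p: "bij_betw p (fst ` P) P"
    unfolding p_def using inj(1) by (simp add: bij_betw_inv_into inj_on_imp_bij_betw)
  have q: "bij_betw q (snd ` P) ?I"
    unfolding q_def using l by (rule bij_betw_inv_into)
  have s: "bij_betw snd P (snd ` P)" using inj(2) by (rule inj_on_imp_bij_betw)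
  define \<sigma> where "\<sigma> i = (if i \<in> ?I then q (snd (p (?r i))) else i)" for i
  have "bij_betw (q \<circ> (snd \<circ> (p \<circ> ?r))) ?I ?I"
    using r p s q by (blast intro: bij_betw_trans)
  then have "bij_betw \<sigma> ?I ?I"
    by (rule bij_betw_cong[THEN iffD1, rotated]) (simp add: \<sigma>_def)
  then have perm: "\<sigma> permutes ?I"
    by (rule bij_imp_permutes) (auto simp: \<sigma>_def)
  have pt: "(?r i, ?l (\<sigma> i)) = p (?r i)" if "i \<in> ?I" for i
  proof -
    have ri: "?r i \<in> fst ` P" using r that by (rule bij_betw_apply)
    then have pi: "p (?r i) \<in> P" using p by (meson bij_betw_apply)
    then have "snd (p (?r i)) \<in> ?l ` ?I" using l unfolding bij_betw_def by blast
    then have "?l (\<sigma> i) = snd (p (?r i))"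
      using that unfolding \<sigma>_def q_def by (simp add: f_inv_into_f)
    moreover have "fst (p (?r i)) = ?r i" unfolding p_def using ri by (rule f_inv_into_f)
    ultimately show ?thesis by (metis prod.collapse)
  qed
  have "P = (p \<circ> ?r) ` ?I" using bij_betw_trans[OF r p] by (simp add: bij_betw_def)
  also have "\<dots> = (\<lambda>i. (?r i, ?l (\<sigma> i))) ` ?I" using pt by simp
  finally have img: "P = {(?r i, ?l (\<sigma> i)) | i. i \<in> ?I}" by blast
  show ?thesis
  proof (rule ex1I[of _ \<sigma>], rule conjI[OF perm img])
    fix \<tau> assume \<tau>: "\<tau> permutes ?I \<and> P = {(?r i, ?l (\<tau> i)) | i. i \<in> ?I}"
    show "\<tau> = \<sigma>"
    proof
      fix i show "\<tau> i = \<sigma> i"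
      proof (cases "i \<in> ?I")
        case True
        have a: "(?r i, ?l (\<tau> i)) \<in> P" using \<tau> True by blast
        have b: "(?r i, ?l (\<sigma> i)) \<in> P" using img True by blast
        from inj_onD[OF inj(1) _ a b] have "?l (\<tau> i) = ?l (\<sigma> i)" by simp
        moreover have "\<tau> i \<in> ?I" "\<sigma> i \<in> ?I"
          using \<tau> perm True by (simp_all only: permutes_in_image)
        ultimately show ?thesis using l by (meson bij_betw_def inj_onD)
      next
        case False
        then show ?thesis using \<tau> perm by (metis permutes_not_in)
      qed
    qed
  qed
qed

type_synonym decorated_tableau = "tableau \<times> real list"

definition decorated_RS ::
    "(real \<times> real) set \<Rightarrow> decorated_tableau \<times> decorated_tableau" where
  "decorated_RS P =
     (let (L, R) = RS (card P) (config_perm P) in ((L, ycoords P), (R, xcoords P)))"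

definition diagram_upto :: "decorated_tableau \<Rightarrow> real \<Rightarrow> (nat \<times> nat) set" where
  "diagram_upto D u =
     (case D of (T, d) \<Rightarrow> {(i, j). (i, j) \<in> shape T \<and> nth1 d (entry T i j) \<le> u})"

text \<open>At \<open>t = 0\<close> both branches give the full shape; see \<open>diagram_upto_full\<close> below.\<close>

definition diagram_process ::
    "real \<Rightarrow> decorated_tableau \<Rightarrow> decorated_tableau \<Rightarrow> real \<Rightarrow> (nat \<times> nat) set" where
  "diagram_process \<theta> DL DR t =
     (if t \<le> 0 then diagram_upto DL (\<theta> + t) else diagram_upto DR (\<theta> - t))"

definition curve_u :: "real \<Rightarrow> real \<Rightarrow> real" where
  "curve_u \<theta> t = (if t \<le> 0 then \<theta> else \<theta> - \<bar>t\<bar>)"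

definition curve_v :: "real \<Rightarrow> real \<Rightarrow> real" where
  "curve_v \<theta> t = (if t \<le> 0 then \<theta> - \<bar>t\<bar> else \<theta>)"

definition rectangle :: "real \<Rightarrow> real \<Rightarrow> (real \<times> real) set" where
  "rectangle u v = {0..u} \<times> {0..v}"

definition config_shape :: "(real \<times> real) set \<Rightarrow> (nat \<times> nat) set" where
  "config_shape P = RS_shape (card P) (config_perm P)"

definition shape_process :: "real \<Rightarrow> (real \<times> real) set \<Rightarrow> real \<Rightarrow> (nat \<times> nat) set" where
  "shape_process \<theta> P t = config_shape (P \<inter> rectangle (curve_u \<theta> t) (curve_v \<theta> t))"

lemma diagram_upto_full:
  assumes "P \<in> configurations \<theta>" and "decorated_RS P = (DL, DR)"
  shows "diagram_upto DL \<theta> = config_shape P" and "diagram_upto DR \<theta> = config_shape P"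
proof -
  let ?n = "card P" and ?\<sigma> = "config_perm P"
  let ?LR = "RS ?n ?\<sigma>"
  have D: "DL = (fst ?LR, ycoords P)" "DR = (snd ?LR, xcoords P)"
    using assms(2) by (auto simp: decorated_RS_def case_prod_beta)
  have fin: "finite P" and sub: "P \<subseteq> {0..\<theta>} \<times> {0..\<theta>}"
    and inj: "inj_on fst P" "inj_on snd P"
    using assms(1) by (auto simp: configurations_def)
  have x: "nth1 (xcoords P) k \<le> \<theta>" if "k \<in> {1..?n}" for k
  proof -
    have "bij_betw (nth1 (xcoords P)) {1..?n} (fst ` P)"
      using nth1_bij_betw[of "fst ` P"] fin inj by (simp add: xcoords_def card_image)
    from bij_betw_apply[OF this that] sub show ?thesis by auto
  qed
  have y: "nth1 (ycoords P) k \<le> \<theta>" if "k \<in> {1..?n}" for k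
  proof -
    have "bij_betw (nth1 (ycoords P)) {1..?n} (snd ` P)"
      using nth1_bij_betw[of "snd ` P"] fin inj by (simp add: ycoords_def card_image)
    from bij_betw_apply[OF this that] sub show ?thesis by auto
  qed
  have perm: "?\<sigma> permutes {1..?n}"
    using theI'[OF config_perm_ex1[OF assms(1)]] unfolding config_perm_def by blast
  have L: "entry (fst ?LR) i j \<in> {1..?n}" if "(i, j) \<in> shape (fst ?LR)" for i j
    using entry_in_set[OF that] RS_entries(1)[of ?n ?\<sigma>] permutes_image[OF perm] by simp
  have R: "entry (snd ?LR) i j \<in> {1..?n}" if "(i, j) \<in> shape (snd ?LR)" for i j
    using entry_in_set[OF that] RS_entries(2)[of ?n ?\<sigma>] by simp
  show "diagram_upto DL \<theta> = config_shape P"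
    unfolding D diagram_upto_def config_shape_def RS_shape_def using L y by auto
  show "diagram_upto DR \<theta> = config_shape P"
    unfolding D diagram_upto_def config_shape_def RS_shape_def RS_common_shape using R x by auto
qed

end

(* Neither half of the process needs the symmetry of RS. Along t \<ge> 0 the points are removed from
   right to left, so the permutation is cut down to a prefix, and the recording tableau stores the
   shapes of the prefixes. Along t \<le> 0 the highest points are removed, so the largest letters are
   deleted from the word; since a bumped letter exceeds the letter that bumps it, the boxes with
   entries at most k evolve during insertion as if the letters above k were absent. The real
   coordinates come in only because the insertion shape depends on the relative order of the
   letters alone. *)
theory Submission
  imports Defs
begin

section \<open>Insertion tableaux of words\<close>

definition insert_word :: "nat list \<Rightarrow> tableau" where
  "insert_word = foldl (\<lambda>T x. fst (row_insert x T)) []"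

lemma insert_word_Nil [simp]: "insert_word [] = []"
  by (simp add: insert_word_def)

lemma insert_word_snoc [simp]:
  "insert_word (w @ [x]) = fst (row_insert x (insert_word w))"
  by (simp add: insert_word_def)

text \<open>\<open>RS\<close> reads its input as a function on positions, and deleting letters
  shifts positions. For lists, deletion is a plain \<open>filter\<close> and passing to a prefix is
  \<open>take\<close>.\<close>

lemma RS_eq_insert_word: "fst (RS n \<sigma>) = insert_word (map \<sigma> [1..<Suc n])"
  by (induction n) (simp_all add: case_prod_beta)

lemma sorted_insert_row: "sorted ys \<Longrightarrow> sorted (fst (insert_row x ys))"
proof (induction ys)
  case (Cons y ys)
  have "set (fst (insert_row x ys)) \<subseteq> insert x (set ys)"
    using insert_row_set[of x ys] by blast
  with Cons show ?case by (auto simp: case_prod_beta)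
qed simp

lemma sorted_rows_row_insert:
  "\<forall>row \<in> set T. sorted row \<Longrightarrow> \<forall>row \<in> set (fst (row_insert x T)). sorted row"
proof (induction T arbitrary: x)
  case (Cons row T)
  have rows: "sorted (fst (insert_row x row))" "\<forall>row \<in> set T. sorted row"
    using Cons.prems sorted_insert_row by simp_all
  show ?case
  proof (cases "snd (insert_row x row)")
    case None
    with rows show ?thesis by (auto simp: case_prod_beta)
  next
    case (Some y)
    with rows Cons.IH[of y] show ?thesis by (auto simp: case_prod_beta)
  qed
qed simp

text \<open>Sorted rows make truncation well behaved: the entries at most \<open>k\<close> form an
  initial segment of each row, so filtering cuts off a tail.\<close>

lemma sorted_rows_insert_word: "\<forall>row \<in> set (insert_word w). sorted row"
  by (induction w rule: rev_induct) (simp, metis insert_word_snoc sorted_rows_row_insert)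

section \<open>Truncation at a threshold \<open>k\<close>\<close>

lemma shape_append_empty_rows: "shape (T @ replicate m []) = shape T"
  by (auto simp: shape_def nth_append split: if_splits)

text \<open>Truncation may leave empty rows at the bottom, so tableaux are compared up to trailing
  empty rows. A letter that is bumped past \<open>T\<close> fills the first empty row or, if there
  is none, opens a new row, with the same result \<open>[x]\<close>; only the number of empty rows
  left over differs.\<close>

lemma row_insert_append_empty_rows:
  "\<exists>m'. fst (row_insert x (T @ replicate m [])) = fst (row_insert x T) @ replicate m' []"
proof (induction T arbitrary: x)
  case Nil
  show ?case by (cases m) auto
next
  case (Cons row T)
  show ?case
  proof (cases "snd (insert_row x row)")
    case None
    then show ?thesis by (auto simp: case_prod_beta)
  next
    case (Some y)
    with Cons.IH[of y] show ?thesis by (auto simp: case_prod_beta)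
  qed
qed

lemma insert_row_bump_greater: "snd (insert_row x ys) = Some y \<Longrightarrow> x < y"
  by (induction ys) (auto simp: case_prod_beta split: if_splits)

text \<open>A letter above \<open>k\<close> is either appended or replaces a still larger one; the
  filter sees neither.\<close>

lemma filter_insert_row_large:
  "k < x \<Longrightarrow> filter (\<lambda>z. z \<le> k) (fst (insert_row x ys)) = filter (\<lambda>z. z \<le> k) ys"
  by (induction ys) (auto simp: case_prod_beta)

text \<open>Truncation commutes with row insertion, except that bumping a letter above
  \<open>k\<close> turns into appending at the end of the truncated row. Hence the bumped letter
  becomes \<open>None\<close> in that case.\<close>

lemma insert_row_filter:
  assumes "sorted ys" and "x \<le> k"
  shows "insert_row x (filter (\<lambda>z. z \<le> k) ys) =
     (filter (\<lambda>z. z \<le> k) (fst (insert_row x ys)),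
      case snd (insert_row x ys) of None \<Rightarrow> None | Some y \<Rightarrow> if y \<le> k then Some y else None)"
  using assms
proof (induction ys)
  case (Cons y ys)
  show ?case
  proof (cases "x < y \<and> \<not> y \<le> k")
    case True
    \<comment> \<open>The bumped \<open>y\<close> exceeds \<open>k\<close>, and by sortedness so
      does everything after it: the truncated row is empty from here on, and \<open>x\<close> is
      appended to it.\<close>
    with Cons.prems have "filter (\<lambda>z. z \<le> k) ys = []"
      by (auto simp: filter_empty_conv)
    with True Cons.prems show ?thesis by simp
  next
    case False
    with Cons show ?thesis by (auto simp: case_prod_beta)
  qed
qed simp

text \<open>All letters along the bumping path exceed \<open>k\<close>. The only visible trace is a
  possible new bottom row, which the filter empties.\<close>

lemma filter_row_insert_large:
  assumes "k < x"
  shows "\<exists>m. map (filter (\<lambda>z. z \<le> k)) (fst (row_insert x T)) =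
     map (filter (\<lambda>z. z \<le> k)) T @ replicate m []"
  using assms
proof (induction T arbitrary: x)
  case Nil
  then show ?case by (intro exI[of _ 1]) simp
next
  case (Cons row T)
  show ?case
  proof (cases "snd (insert_row x row)")
    case None
    with filter_insert_row_large[OF Cons.prems] show ?thesis by (auto simp: case_prod_beta)
  next
    case (Some y)
    with Cons.prems insert_row_bump_greater[OF Some] Cons.IH[of y]
      filter_insert_row_large[OF Cons.prems]
    show ?thesis by (auto simp: case_prod_beta)
  qed
qed

text \<open>The full and the truncated insertion follow the same bumping path as long as the bumped
  letters are at most \<open>k\<close>.\<close>

lemma filter_row_insert_small:
  assumes "\<forall>row \<in> set T. sorted row" and "x \<le> k"
  shows "\<exists>m. map (filter (\<lambda>z. z \<le> k)) (fst (row_insert x T)) =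
     fst (row_insert x (map (filter (\<lambda>z. z \<le> k)) T)) @ replicate m []"
  using assms
proof (induction T arbitrary: x)
  case (Cons row T)
  have row: "sorted row" using Cons.prems by simp
  note ins = insert_row_filter[OF row Cons.prems(2)]
  show ?case
  proof (cases "snd (insert_row x row)")
    case None
    with ins show ?thesis by (auto simp: case_prod_beta)
  next
    case (Some y)
    show ?thesis
    proof (cases "y \<le> k")
      case True
      with Some ins Cons.IH[of y] Cons.prems(1) show ?thesis by (auto simp: case_prod_beta)
    next
      case False
      \<comment> \<open>The truncated insertion ends in this row, while the full one carries
        \<open>y\<close> above \<open>k\<close> into the rows below, where the filter does not see
        it.\<close>
      with Some ins filter_row_insert_large[of k y T] show ?thesis
        by (auto simp: case_prod_beta)
    qed
  qed
qed simp

lemma filter_insert_word: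
  "\<exists>m. map (filter (\<lambda>z. z \<le> k)) (insert_word w) =
     insert_word (filter (\<lambda>z. z \<le> k) w) @ replicate m []"
proof (induction w rule: rev_induct)
  case (snoc x w)
  let ?F = "map (filter (\<lambda>z. z \<le> k))" and ?f = "filter (\<lambda>z. z \<le> k)"
  from snoc obtain m where m: "?F (insert_word w) = insert_word (?f w) @ replicate m []"
    by blast
  show ?case
  proof (cases "x \<le> k")
    case True
    obtain m1 where "?F (fst (row_insert x (insert_word w))) =
        fst (row_insert x (insert_word (?f w) @ replicate m [])) @ replicate m1 []"
      using filter_row_insert_small[OF sorted_rows_insert_word True] m by metis
    \<comment> \<open>The empty rows left by earlier letters are moved past the insertion of
      \<open>x\<close>, to be merged with the \<open>m1\<close> new ones.\<close>
    moreover obtain m2 where "fst (row_insert x (insert_word (?f w) @ replicate m [])) =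
        fst (row_insert x (insert_word (?f w))) @ replicate m2 []"
      using row_insert_append_empty_rows by blast
    ultimately have "?F (insert_word (w @ [x])) =
        insert_word (?f (w @ [x])) @ replicate (m2 + m1) []"
      using True by (simp add: replicate_add)
    then show ?thesis by blast
  next
    case False
    then obtain m1 where "?F (fst (row_insert x (insert_word w))) =
        ?F (insert_word w) @ replicate m1 []"
      using filter_row_insert_large[of k x] by (meson not_le)
    with m False have "?F (insert_word (w @ [x])) =
        insert_word (?f (w @ [x])) @ replicate (m + m1) []"
      by (simp add: replicate_add)
    then show ?thesis by blast
  qed
qed simp

section \<open>From filtered rows to sets of boxes\<close>

lemma sorted_length_filter_le_iff:
  fixes xs :: "'a::linorder list"
  assumes "sorted xs" and "j < length xs"
  shows "j < length (filter (\<lambda>z. z \<le> k) xs) \<longleftrightarrow> xs ! j \<le> k"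
  using assms
proof (induction xs arbitrary: j)
  case (Cons a xs)
  show ?case
  proof (cases "a \<le> k")
    case True
    with Cons show ?thesis by (cases j) auto
  next
    case False
    then have "filter (\<lambda>z. z \<le> k) xs = []"
      using Cons.prems by (auto simp: filter_empty_conv)
    moreover have "a \<le> (a # xs) ! j"
      using Cons.prems by (cases j) auto
    ultimately show ?thesis using False by auto
  qed
qed simp

lemma shape_filter:
  assumes "\<forall>row \<in> set T. sorted row"
  shows "shape (map (filter (\<lambda>z. z \<le> k)) T) = {(i, j). (i, j) \<in> shape T \<and> entry T i j \<le> k}"
proof -
  \<comment> \<open>Successor indices remove the truncated subtraction in \<open>shape\<close> and
    \<open>entry\<close>; no box is lost, because rows and columns are numbered from 1.\<close>
  have "Suc j \<le> length (filter (\<lambda>z. z \<le> k) (T ! i)) \<longleftrightarrow>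
      Suc j \<le> length (T ! i) \<and> T ! i ! j \<le> k" if "i < length T" for i j
    using sorted_length_filter_le_iff[of "T ! i" j k] assms that
    by (cases "j < length (T ! i)") (auto simp: Suc_le_eq dest: less_le_trans[OF _ length_filter_le])
  then have "(Suc i, Suc j) \<in> shape (map (filter (\<lambda>z. z \<le> k)) T) \<longleftrightarrow>
      (Suc i, Suc j) \<in> shape T \<and> entry T (Suc i) (Suc j) \<le> k" for i j
    by (auto simp: shape_def entry_def)
  moreover have "\<exists>i' j'. i = Suc i' \<and> j = Suc j'" if "(i, j) \<in> shape U" for i j U
    using that by (auto simp: shape_def Suc_le_eq dest!: gr0_implies_Suc)
  ultimately show ?thesis by auto (metis+)
qed

text \<open>The trailing empty rows disappear here, since \<open>shape\<close> does not see
  them.\<close>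

lemma insert_word_restrict:
  "{(i, j). (i, j) \<in> shape (insert_word w) \<and> entry (insert_word w) i j \<le> k} =
     shape (insert_word (filter (\<lambda>z. z \<le> k) w))"
  unfolding shape_filter[OF sorted_rows_insert_word, symmetric]
  using filter_insert_word[of k w] by (metis shape_append_empty_rows)

section \<open>The recording tableau\<close>

lemma append_at_restrict:
  assumes "k < m"
  shows "{(i, j). (i, j) \<in> shape (append_at m r T) \<and> entry (append_at m r T) i j \<le> k} =
     {(i, j). (i, j) \<in> shape T \<and> entry T i j \<le> k}"
  using assms
  by (auto simp: append_at_def shape_def entry_def nth_append nth_list_update le_Suc_eq
      split: if_splits)

text \<open>The entry of a box is the step at which the box was added, so the later steps only add
  boxes with entries above \<open>k\<close>.\<close>

lemma recording_restrict:
  assumes "k \<le> n"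
  shows "{(i, j). (i, j) \<in> shape (snd (RS n \<sigma>)) \<and> entry (snd (RS n \<sigma>)) i j \<le> k} =
     shape (fst (RS k \<sigma>))"
  using assms
\<comment> \<open>The induction starts at \<open>n = k\<close>, where every entry is at most
  \<open>k\<close> and the restriction keeps the whole shape.\<close>
proof (induction n rule: dec_induct)
  case base
  have "entry (snd (RS k \<sigma>)) i j \<le> k" if "(i, j) \<in> shape (snd (RS k \<sigma>))" for i j
    using entry_in_set[OF that] RS_entries(2)[of k \<sigma>] by simp
  then show ?case by (auto simp: RS_common_shape)
next
  case (step n)
  have "k < Suc n" using step.hyps by simp
  have "snd (RS (Suc n) \<sigma>) =
      append_at (Suc n) (snd (row_insert (\<sigma> (Suc n)) (fst (RS n \<sigma>)))) (snd (RS n \<sigma>))"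
    by (simp add: case_prod_beta)
  with append_at_restrict[OF \<open>k < Suc n\<close>] step.IH show ?case by (simp only:)
qed

section \<open>Dependence on the relative order of letters\<close>

lemma insert_row_rel:
  assumes less: "\<And>x x' y y'. R x x' \<Longrightarrow> R y y' \<Longrightarrow> x < y \<longleftrightarrow> x' < y'"
    and "R x x'" and "list_all2 R ys ys'"
  shows "list_all2 R (fst (insert_row x ys)) (fst (insert_row x' ys')) \<and>
     rel_option R (snd (insert_row x ys)) (snd (insert_row x' ys'))"
  using assms(3,2)
proof (induction rule: list_all2_induct)
  case (Cons y ys y' ys')
  then show ?case using less[OF Cons.prems Cons.hyps(1)] by (simp add: case_prod_beta)
qed simp

text \<open>Insertion looks at letters only through \<open><\<close>, so it respects any relation
  along which comparisons agree. Bumped letters are again related, which carries the argument to the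
  next row.\<close>

lemma row_insert_rel:
  assumes less: "\<And>x x' y y'. R x x' \<Longrightarrow> R y y' \<Longrightarrow> x < y \<longleftrightarrow> x' < y'"
    and "R x x'" and "list_all2 (list_all2 R) T T'"
  shows "list_all2 (list_all2 R) (fst (row_insert x T)) (fst (row_insert x' T'))"
  using assms(3,2)
proof (induction arbitrary: x x' rule: list_all2_induct)
  case (Cons row T row' T')
  have ins: "list_all2 R (fst (insert_row x row)) (fst (insert_row x' row'))"
    "rel_option R (snd (insert_row x row)) (snd (insert_row x' row'))"
    using insert_row_rel[OF less Cons.prems Cons.hyps(1)] by blast+
  from ins(2) show ?case
  proof (cases rule: option.rel_cases)
    case None
    with ins(1) Cons.hyps show ?thesis by (simp add: case_prod_beta)
  next
    case (Some y y')
    with ins(1) Cons.IH[of y y'] show ?thesis by (simp add: case_prod_beta)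
  qed
qed simp

lemma insert_word_rel:
  assumes less: "\<And>x x' y y'. R x x' \<Longrightarrow> R y y' \<Longrightarrow> x < y \<longleftrightarrow> x' < y'"
    and "list_all2 R w w'"
  shows "list_all2 (list_all2 R) (insert_word w) (insert_word w')"
  using assms(2)
proof (induction w arbitrary: w' rule: rev_induct)
  case (snoc x w)
  from snoc.prems obtain v x' where "w' = v @ [x']" "list_all2 R w v" "R x x'"
    by (auto simp: list_all2_append1 list_all2_Cons1)
  with snoc.IH[of v] row_insert_rel[OF less] show ?case by simp
qed simp

lemma shape_list_all2:
  assumes "list_all2 (list_all2 R) T T'"
  shows "shape T = shape T'"
proof -
  have "length T = length T'" using assms by (rule list_all2_lengthD)
  moreover have "length (T ! k) = length (T' ! k)" if "k < length T" for k
    using assms that list_all2_nthD list_all2_lengthD by blast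
  ultimately show ?thesis unfolding shape_def by auto
qed

text \<open>The maps \<open>f\<close> and \<open>g\<close> give the letters values in a common
  order, and equal value lists make the words order isomorphic. This compares ranks in different
  configurations through real y-coordinates.\<close>

lemma shape_insert_word_cong:
  fixes f g :: "nat \<Rightarrow> 'a::linorder"
  assumes "strict_mono_on (set w) f" and "strict_mono_on (set w') g" and eq: "map f w = map g w'"
  shows "shape (insert_word w) = shape (insert_word w')"
proof -
  \<comment> \<open>Letters are related when they have the same value; membership in the words is
    included so that strict monotonicity applies.\<close>
  define R where "R x x' \<longleftrightarrow> x \<in> set w \<and> x' \<in> set w' \<and> f x = g x'" for x x'
  have "x < y \<longleftrightarrow> x' < y'" if "R x x'" "R y y'" for x x' y y'
    using that strict_mono_on_less[OF assms(1)] strict_mono_on_less[OF assms(2)]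
    unfolding R_def by metis
  moreover have "list_all2 R w w'"
    unfolding list_all2_conv_all_nth R_def
    using eq by (metis length_map nth_map nth_mem)
  ultimately show ?thesis by (intro shape_list_all2 insert_word_rel)
qed

section \<open>Coordinate lists and ranks\<close>

lemma map_nth1: "map (nth1 zs) [1..<Suc (length zs)] = zs"
  by (intro nth_equalityI) (simp_all add: nth1_def del: upt_Suc)

lemma strict_mono_on_nth1:
  assumes "sorted_wrt (<) zs"
  shows "strict_mono_on {1..length zs} (nth1 zs)"
proof (rule strict_mono_onI)
  fix i j assume "i \<in> {1..length zs}" "j \<in> {1..length zs}" "i < j"
  then show "nth1 zs i < nth1 zs j"
    unfolding nth1_def by (intro sorted_wrt_nth_less[OF assms]) auto
qed

lemma sorted_filter_le_eq_take:
  fixes zs :: "'a::linorder list"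
  assumes "sorted zs"
  shows "filter (\<lambda>z. z \<le> c) zs = take (length (filter (\<lambda>z. z \<le> c) zs)) zs"
  using assms
proof (induction zs)
  case (Cons z zs)
  then show ?case
  proof (cases "z \<le> c")
    case False
    with Cons.prems have "filter (\<lambda>z. z \<le> c) zs = []"
      by (auto simp: filter_empty_conv)
    with False show ?thesis by simp
  qed simp
qed simp

text \<open>Converts a real threshold into a rank: in a sorted list, the elements at most
  \<open>c\<close> come first, so counting them gives the last rank that passes.\<close>

lemma nth1_le_iff:
  fixes zs :: "'a::linorder list"
  assumes "sorted zs" and "i \<in> {1..length zs}"
  shows "nth1 zs i \<le> c \<longleftrightarrow> i \<le> length (filter (\<lambda>z. z \<le> c) zs)"
proof -
  obtain j where "i = Suc j" "j < length zs" using assms(2) by (cases i) auto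
  with sorted_length_filter_le_iff[OF assms(1), of j c] show ?thesis
    by (simp add: nth1_def Suc_le_eq)
qed

section \<open>Words and heights of configurations\<close>

definition config_word :: "(real \<times> real) set \<Rightarrow> nat list" where
  "config_word P = map (config_perm P) [1..<Suc (card P)]"

text \<open>Views the configuration as the graph of a function. The value is meaningful only when
  \<open>x\<close> is the x-coordinate of a point of \<open>P\<close>.\<close>

definition height :: "(real \<times> real) set \<Rightarrow> real \<Rightarrow> real" where
  "height P x = snd (inv_into P fst x)"

context
  fixes \<theta> :: real and P :: "(real \<times> real) set"
  assumes P: "P \<in> configurations \<theta>"
begin

lemma length_coords: "length (xcoords P) = card P" "length (ycoords P) = card P"
  using P by (simp_all add: configurations_def xcoords_def ycoords_def card_image)

lemma sorted_coords: "sorted_wrt (<) (xcoords P)" "sorted_wrt (<) (ycoords P)"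
  by (simp_all add: xcoords_def ycoords_def)

lemma set_xcoords: "set (xcoords P) = fst ` P"
  using P by (simp add: configurations_def xcoords_def)

lemma height_fst:
  assumes "p \<in> P"
  shows "height P (fst p) = snd p"
  using P assms by (simp add: configurations_def height_def)

lemma config_perm:
  "config_perm P permutes {1..card P}"
  "P = {(nth1 (xcoords P) i, nth1 (ycoords P) (config_perm P i)) | i. i \<in> {1..card P}}"
  using theI'[OF config_perm_ex1[OF P]] unfolding config_perm_def by blast+

lemma set_config_word: "set (config_word P) = {1..card P}"
  using permutes_image[OF config_perm(1)]
  by (simp add: config_word_def atLeastLessThanSuc_atLeastAtMost del: upt_Suc)

text \<open>Both sides list the y-coordinates of the points from left to right. Unlike ranks, these
  reals do not change when points are removed.\<close>

lemma map_ycoords_config_word: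
  "map (nth1 (ycoords P)) (config_word P) = map (height P) (xcoords P)"
proof -
  have "nth1 (ycoords P) (config_perm P i) = height P (nth1 (xcoords P) i)"
    if "i \<in> {1..card P}" for i
  proof -
    have "(nth1 (xcoords P) i, nth1 (ycoords P) (config_perm P i)) \<in> P"
      using that config_perm(2) by blast
    from height_fst[OF this] show ?thesis by simp
  qed
  then have "map (nth1 (ycoords P)) (config_word P) =
      map (height P) (map (nth1 (xcoords P)) [1..<Suc (card P)])"
    by (simp add: config_word_def del: upt_Suc)
  also have "\<dots> = map (height P) (xcoords P)"
    using map_nth1[of "xcoords P"] length_coords(1) by simp
  finally show ?thesis .
qed

lemma config_shape_eq: "config_shape P = shape (insert_word (config_word P))"
  by (simp add: config_shape_def RS_shape_def RS_eq_insert_word config_word_def del: upt_Suc)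

lemma strict_mono_on_ycoords: "strict_mono_on {1..card P} (nth1 (ycoords P))"
  using strict_mono_on_nth1[OF sorted_coords(2)] length_coords(2) by simp

end

lemma subset_configurations:
  "P \<in> configurations \<theta> \<Longrightarrow> Q \<subseteq> P \<Longrightarrow> Q \<in> configurations \<theta>"
  unfolding configurations_def by (auto intro: finite_subset inj_on_subset)

text \<open>The letters of \<open>w\<close> are ranks within \<open>P\<close>, those of \<open>config_word Q\<close> ranks within \<open>Q\<close>.\<close>

lemma config_shape_subset:
  assumes P: "P \<in> configurations \<theta>" and "Q \<subseteq> P" and w: "set w \<subseteq> {1..card P}"
    and eq: "map (nth1 (ycoords P)) w = map (height P) (xcoords Q)"
  shows "shape (insert_word w) = config_shape Q"
proof -
  have Q: "Q \<in> configurations \<theta>" using assms(1,2) by (rule subset_configurations)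
  \<comment> \<open>A point of \<open>Q\<close> has the same height in \<open>P\<close>, so both
    words have the same list of real values.\<close>
  have "height Q x = height P x" if "x \<in> set (xcoords Q)" for x
    using that \<open>Q \<subseteq> P\<close> height_fst[OF P] height_fst[OF Q] set_xcoords[OF Q] by force
  then have "map (nth1 (ycoords Q)) (config_word Q) = map (nth1 (ycoords P)) w"
    unfolding eq map_ycoords_config_word[OF Q] by simp
  moreover have "strict_mono_on (set w) (nth1 (ycoords P))"
    using strict_mono_on_ycoords[OF P] w by (rule monotone_on_subset)
  moreover have "strict_mono_on (set (config_word Q)) (nth1 (ycoords Q))"
    using strict_mono_on_ycoords[OF Q] by (simp add: set_config_word[OF Q])
  ultimately show ?thesis
    unfolding config_shape_eq[OF Q] by (intro shape_insert_word_cong) auto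
qed

text \<open>Both lists are sorted and distinct, so it suffices to compare their sets;
  \<open>height P\<close> recovers the point from its x-coordinate.\<close>

lemma xcoords_filter:
  assumes P: "P \<in> configurations \<theta>"
  shows "xcoords {p \<in> P. S p} = filter (\<lambda>x. S (x, height P x)) (xcoords P)"
proof -
  have Q: "{p \<in> P. S p} \<in> configurations \<theta>" using P by (rule subset_configurations) auto
  have "set (xcoords {p \<in> P. S p}) = set (filter (\<lambda>x. S (x, height P x)) (xcoords P))"
    unfolding set_xcoords[OF Q] set_filter set_xcoords[OF P]
    using height_fst[OF P] by force
  then show ?thesis
    using sorted_coords(1)[OF P] sorted_coords(1)[OF Q]
    by (intro sorted_distinct_set_unique) (auto simp: strict_sorted_iff sorted_wrt_filter)
qed

section \<open>The two halves of the process\<close>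

lemma diagram_upto_insertion:
  assumes P: "P \<in> configurations \<theta>"
  shows "diagram_upto (fst (RS (card P) (config_perm P)), ycoords P) v =
     config_shape {p \<in> P. snd p \<le> v}"
proof -
  let ?T = "insert_word (config_word P)"
  \<comment> \<open>The number of points of height at most \<open>v\<close>; it is the rank
    threshold that replaces \<open>v\<close> on the labels \<open>1..card P\<close>.\<close>
  define k where "k = length (filter (\<lambda>y. y \<le> v) (ycoords P))"
  have iff: "nth1 (ycoords P) e \<le> v \<longleftrightarrow> e \<le> k" if "e \<in> {1..card P}" for e
    using that nth1_le_iff[of "ycoords P" e v] sorted_coords(2)[OF P] length_coords(2)[OF P]
    by (simp add: k_def strict_sorted_iff)
  have T: "fst (RS (card P) (config_perm P)) = ?T"
    by (simp add: RS_eq_insert_word config_word_def del: upt_Suc)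
  have "entry ?T i j \<in> {1..card P}" if "(i, j) \<in> shape ?T" for i j
    using entry_in_set[OF that] RS_entries(1)[of "card P" "config_perm P"]
      permutes_image[OF config_perm(1)[OF P]] unfolding T by simp
  then have "diagram_upto (?T, ycoords P) v = {(i, j). (i, j) \<in> shape ?T \<and> entry ?T i j \<le> k}"
    unfolding diagram_upto_def using iff by auto
  also have "\<dots> = shape (insert_word (filter (\<lambda>e. e \<le> k) (config_word P)))"
    by (rule insert_word_restrict)
  also have "\<dots> = config_shape {p \<in> P. snd p \<le> v}"
  proof (rule config_shape_subset[OF P])
    show "set (filter (\<lambda>e. e \<le> k) (config_word P)) \<subseteq> {1..card P}"
      by (auto simp: set_config_word[OF P])
    \<comment> \<open>Deleting letters by rank is deleting them by height, a condition on values
      that can be moved past \<open>map\<close>.\<close>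
    have "filter (\<lambda>e. e \<le> k) (config_word P) =
        filter (\<lambda>e. nth1 (ycoords P) e \<le> v) (config_word P)"
      by (intro filter_cong refl) (simp only: set_config_word[OF P] iff)
    then have "map (nth1 (ycoords P)) (filter (\<lambda>e. e \<le> k) (config_word P)) =
        filter (\<lambda>y. y \<le> v) (map (nth1 (ycoords P)) (config_word P))"
      by (simp add: filter_map comp_def)
    also have "\<dots> = map (height P) (filter (\<lambda>x. height P x \<le> v) (xcoords P))"
      by (simp add: map_ycoords_config_word[OF P] filter_map comp_def)
    finally show "map (nth1 (ycoords P)) (filter (\<lambda>e. e \<le> k) (config_word P)) =
        map (height P) (xcoords {p \<in> P. snd p \<le> v})"
      by (simp add: xcoords_filter[OF P])
  qed auto
  finally show ?thesis by (simp add: T)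
qed

lemma diagram_upto_recording:
  assumes P: "P \<in> configurations \<theta>"
  shows "diagram_upto (snd (RS (card P) (config_perm P)), xcoords P) u =
     config_shape {p \<in> P. fst p \<le> u}"
proof -
  let ?T = "snd (RS (card P) (config_perm P))"
  define k where "k = length (filter (\<lambda>x. x \<le> u) (xcoords P))"
  have iff: "nth1 (xcoords P) e \<le> u \<longleftrightarrow> e \<le> k" if "e \<in> {1..card P}" for e
    using that nth1_le_iff[of "xcoords P" e u] sorted_coords(1)[OF P] length_coords(1)[OF P]
    by (simp add: k_def strict_sorted_iff)
  have k: "k \<le> card P"
    using length_filter_le[of _ "xcoords P"] length_coords(1)[OF P] by (simp add: k_def)
  have "entry ?T i j \<in> {1..card P}" if "(i, j) \<in> shape ?T" for i j
    using entry_in_set[OF that] RS_entries(2)[of "card P" "config_perm P"] by simp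
  then have "diagram_upto (?T, xcoords P) u = {(i, j). (i, j) \<in> shape ?T \<and> entry ?T i j \<le> k}"
    unfolding diagram_upto_def using iff by auto
  also have "\<dots> = shape (fst (RS k (config_perm P)))"
    using k by (rule recording_restrict)
  \<comment> \<open>The first \<open>k\<close> insertion steps read only the first \<open>k\<close>
    letters.\<close>
  also have "\<dots> = shape (insert_word (take k (config_word P)))"
    using k by (simp add: RS_eq_insert_word config_word_def take_map del: upt_Suc)
  also have "\<dots> = config_shape {p \<in> P. fst p \<le> u}"
  proof (rule config_shape_subset[OF P])
    show "set (take k (config_word P)) \<subseteq> {1..card P}"
      using set_take_subset[of k "config_word P"] by (simp only: set_config_word[OF P])
    have "map (nth1 (ycoords P)) (take k (config_word P)) = map (height P) (take k (xcoords P))"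
      by (metis map_ycoords_config_word[OF P] take_map)
    \<comment> \<open>The \<open>k\<close> leftmost points are exactly those with x-coordinate at
      most \<open>u\<close>.\<close>
    also have "take k (xcoords P) = filter (\<lambda>x. x \<le> u) (xcoords P)"
      using sorted_filter_le_eq_take[of "xcoords P" u] sorted_coords(1)[OF P]
      by (simp add: k_def strict_sorted_iff)
    finally show "map (nth1 (ycoords P)) (take k (config_word P)) =
        map (height P) (xcoords {p \<in> P. fst p \<le> u})"
      by (simp add: xcoords_filter[OF P])
  qed auto
  finally show ?thesis .
qed

theorem theorem4p1:
  fixes \<theta> :: real and P :: "(real \<times> real) set"
    and DL DR :: decorated_tableau
  assumes "\<theta> > 0"
    and "P \<in> configurations \<theta>"
    and "decorated_RS P = (DL, DR)"
  shows "\<forall>t \<in> {-\<theta>..\<theta>}. diagram_process \<theta> DL DR t = shape_process \<theta> P t"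
proof
  fix t assume "t \<in> {-\<theta>..\<theta>}"
  let ?LR = "RS (card P) (config_perm P)"
  have D: "DL = (fst ?LR, ycoords P)" "DR = (snd ?LR, xcoords P)"
    using assms(3) by (auto simp: decorated_RS_def case_prod_beta)
  have sub: "P \<subseteq> {0..\<theta>} \<times> {0..\<theta>}"
    using assms(2) by (simp add: configurations_def)
  show "diagram_process \<theta> DL DR t = shape_process \<theta> P t"
  proof (cases "t \<le> 0")
    case True
    \<comment> \<open>The width is still \<open>\<theta>\<close>, so the square containing
      \<open>P\<close> supplies every bound except the height
      \<open>\<theta> - \<bar>t\<bar> = \<theta> + t\<close>.\<close>
    then have "P \<inter> rectangle (curve_u \<theta> t) (curve_v \<theta> t) = {p \<in> P. snd p \<le> \<theta> + t}"
      using sub by (auto simp: rectangle_def curve_u_def curve_v_def)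
    with True diagram_upto_insertion[OF assms(2)] show ?thesis
      by (simp add: diagram_process_def shape_process_def D)
  next
    case False
    \<comment> \<open>Here the height is \<open>\<theta>\<close>, and only the width
      \<open>\<theta> - t\<close> cuts off points.\<close>
    then have "P \<inter> rectangle (curve_u \<theta> t) (curve_v \<theta> t) = {p \<in> P. fst p \<le> \<theta> - t}"
      using sub by (auto simp: rectangle_def curve_u_def curve_v_def)
    with False diagram_upto_recording[OF assms(2)] show ?thesis
      by (simp add: diagram_process_def shape_process_def D)
  qed
qed

end
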